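(* Let $\mathbb{A}$ be a $3$-letter alphabet, $\pi=(<_D,<_A)$ a pair of distinct total orders on $\mathbb{A}$, and $T$ a discrete $3$-interval exchange transformation with pair of orders $\pi$ and length vector $\lambda$. Then the number of orbits of $T$ is equal to $\gcd\Omega\lambda$, the greatest common divisor of the entries of the vector $\Omega\lambda$. Hence $T$ is minimal if and only if $\gcd\Omega\lambda=1$.
   Context: $\Omega=(\Omega_{i,j})_{i,j\in\mathbb{A}}$ is the skew-symmetric matrix with $\Omega_{i,j}=+1$ if $j<_A i$ and $i<_D j$; $\Omega_{i,j}=-1$ if $j<_D i$ and $i<_A j$; $\Omega_{i,j}=0$ otherwise. A discrete $k$-interval exchange transformation with pair of orders $\pi=(<_D,<_A)$ on a $k$-letter alphabet $\mathbb{A}$ and length vector $\lambda=(\lambda_a)_{a\in\mathbb{A}}$ (nonnegative integers, with sum $m\ge1$) is the bijection $T:I\to I$ of $I=\{1,\ldots,m\}$ obtained as follows: $I$ is partitioned into $k$ intervals $I_a$ ($a\in\mathbb{A}$) of consecutive integers with $|I_a|=\lambda_a$, placed from left to right in increasing order of $a$ with respect to $<_D$; the images $T(I_a)$ are also intervals partitioning $I$, placed from left to right in increasing order of $a$ with respect to $<_A$; and the restriction of $T$ to each $I_a$ is a translation. $T$ is minimal if it consists of a single orbit.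
   Formalization: Added hypothesis: every letter whose row of Ω is zero has length 0. Without it the claim fails: for 1<_D2<_D3, 2<_A1<_A3, λ=(1,1,1), T has 2 orbits but gcd Ωλ=1. *)

theory Defs
  imports "HOL-Analysis.Finite_Cartesian_Product" "HOL-Combinatorics.Orbits"
begin

text \<open>
  The alphabet is a finite type \<open>'a\<close>. A pair of orders consists of two strict total orders
  \<open>D\<close>, \<open>A\<close> on it, where \<open>(a, b) \<in> D\<close> means that \<open>a\<close> precedes \<open>b\<close> in the domain
  and \<open>(a, b) \<in> A\<close> that \<open>a\<close> precedes \<open>b\<close> in the image.
\<close>

abbreviation strict_total_order :: "'a rel \<Rightarrow> bool" where
  "strict_total_order r \<equiv> strict_linear_order_on UNIV r"

definition Omega :: "'a::finite rel \<Rightarrow> 'a rel \<Rightarrow> int ^ 'a ^ 'a" where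
  "Omega D A = (\<chi> i j. if (j, i) \<in> A \<and> (i, j) \<in> D then 1
                      else if (j, i) \<in> D \<and> (i, j) \<in> A then -1
                      else 0)"

definition total_length :: "nat ^ 'a::finite \<Rightarrow> nat" where
  "total_length l = (\<Sum>a\<in>UNIV. l $ a)"

text \<open>
  Placing intervals of lengths \<open>l $ a\<close> from left to right in the order \<open>R\<close>, the interval of
  \<open>a\<close> starts just after the intervals of all letters smaller than \<open>a\<close>.
\<close>

definition offset :: "'a::finite rel \<Rightarrow> nat ^ 'a \<Rightarrow> 'a \<Rightarrow> nat" where
  "offset R l a = (\<Sum>b | (b, a) \<in> R. l $ b)"

definition block :: "'a::finite rel \<Rightarrow> nat ^ 'a \<Rightarrow> 'a \<Rightarrow> nat set" where
  "block R l a = {offset R l a <.. offset R l a + l $ a}"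

text \<open>Only the values of \<open>T\<close> on \<open>{1..total_length l}\<close> are relevant.\<close>

definition discrete_iet ::
    "'a::finite rel \<Rightarrow> 'a rel \<Rightarrow> nat ^ 'a \<Rightarrow> (nat \<Rightarrow> nat) \<Rightarrow> bool" where
  "discrete_iet D A l T \<longleftrightarrow>
     bij_betw T {1..total_length l} {1..total_length l} \<and>
     (\<forall>a. T ` block D l a = block A l a \<and>
          (\<exists>c::int. \<forall>x\<in>block D l a. int (T x) = int x + c))"

text \<open>
  The library's \<open>orbit T x\<close> is the forward orbit \<open>{(T ^^ n) x | n. n > 0}\<close>; since \<open>T\<close> permutes
  a finite interval, this is the full orbit and contains \<open>x\<close>.
\<close>

definition iet_orbits :: "nat ^ 'a::finite \<Rightarrow> (nat \<Rightarrow> nat) \<Rightarrow> nat set set" where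
  "iet_orbits l T = orbit T ` {1..total_length l}"

definition minimal_iet :: "nat ^ 'a::finite \<Rightarrow> (nat \<Rightarrow> nat) \<Rightarrow> bool" where
  "minimal_iet l T \<longleftrightarrow> is_singleton (iet_orbits l T)"

definition Omega_vec :: "'a::finite rel \<Rightarrow> 'a rel \<Rightarrow> nat ^ 'a \<Rightarrow> int ^ 'a" where
  "Omega_vec D A l = Omega D A *v (\<chi> a. int (l $ a))"

definition gcd_entries :: "int ^ 'a::finite \<Rightarrow> int" where
  "gcd_entries v = Gcd (range (\<lambda>a. v $ a))"

text \<open>
  A letter \<open>a\<close> with \<open>Omega D A $ a = 0\<close> compares with every other letter in the same way for
  \<open>D\<close> and \<open>A\<close>, so \<open>T\<close> fixes each of the \<open>l $ a\<close> points of its interval. The following condition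
  says that there are no such letters of positive length. It holds for every irreducible pair
  of orders on at least two letters. For two distinct orders on three letters, the number of orbits
  differs from the gcd of the entries of \<open>Omega_vec D A l\<close> whenever it fails: for
  \<open>1 <\<^sub>D 2 <\<^sub>D 3\<close>, \<open>2 <\<^sub>A 1 <\<^sub>A 3\<close> and lengths \<open>(1, 1, 1)\<close> there are two orbits, but the vector is
  \<open>(1, -1, 0)\<close>.
\<close>

definition no_fixed_letter :: "'a::finite rel \<Rightarrow> 'a rel \<Rightarrow> nat ^ 'a \<Rightarrow> bool" where
  "no_fixed_letter D A l \<longleftrightarrow> (\<forall>a. Omega D A $ a = 0 \<longrightarrow> l $ a = 0)"

end

theory Submission
  imports Defs "HOL-Number_Theory.Cong"
begin

text \<open>
  The count is a gcd because \<open>T\<close> is the map that the rotation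
  \<open>x \<mapsto> x + p\<close> of the cyclic group of order \<open>p + q\<close> induces on an interval of \<open>m\<close>
  consecutive points, where \<open>p\<close> and \<open>- q\<close> are the largest and the smallest entry of
  \<open>\<Omega>\<lambda>\<close>. The orbits of this rotation are the residue classes modulo
  \<open>gcd (p + q) p = gcd p q\<close>, and an induced map has one orbit for each of them that meets the
  interval; all of them do, since \<open>gcd p q \<le> m\<close>.

  The link with \<open>\<Omega>\<close> is that the entry of \<open>\<Omega>\<lambda>\<close> at \<open>a\<close> is the amount by which \<open>T\<close>
  translates the interval of \<open>a\<close> (\<open>discrete_iet_translation\<close>). For the
  order-reversing exchange of intervals of lengths \<open>x, y, z\<close>, these amounts are \<open>p = y + z\<close>,
  \<open>p - q\<close> and \<open>- q = - (x + y)\<close>: the middle interval consists of the points that the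
  rotation takes out of the interval and brings back at the next step. For the other pairs of distinct
  orders \<open>T\<close> exchanges only two intervals, because two letters are adjacent in both orders and move
  together or because the letter fixed by \<open>\<Omega>\<close> has length zero; then \<open>T\<close> is itself a
  rotation and \<open>m = p + q\<close>.

  Orbits of \<open>T\<close> lie in residue classes modulo \<open>gcd p q\<close>, since every translation amount is
  divisible by it. The converse (\<open>invariant_eq_if_cong\<close>) has the shape of the Fine--Wilf
  theorem: a \<open>T\<close>-invariant function on \<open>{1..m}\<close> extends to a function on the integers with
  periods \<open>p + q\<close> and \<open>p\<close>, which by Bezout has period \<open>gcd p q\<close>. Applied to the
  function sending a point to its orbit, this makes congruent points share an orbit.
\<close>

section \<open>Periods of functions on the integers\<close>

lemma period_mult:
  fixes G :: "int \<Rightarrow> 'b"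
  assumes "\<And>z. G (z + p) = G z"
  shows "G (z + u * p) = G z"
proof (induction u rule: int_induct[where k = 0])
  case (step1 i)
  then show ?case using assms[of "z + i * p"] by (simp add: algebra_simps)
next
  case (step2 i)
  then show ?case using assms[of "z + (i - 1) * p"] by (simp add: algebra_simps)
qed simp

text \<open>The periods form an additive subgroup of the integers, so Bezout's identity applies.\<close>

lemma period_gcd:
  fixes G :: "int \<Rightarrow> 'b"
  assumes p: "\<And>z. G (z + p) = G z" and q: "\<And>z. G (z + q) = G z"
    and cong: "[x = y] (mod gcd p q)"
  shows "G x = G y"
proof -
  obtain k where k: "x = y + gcd p q * k"
    using cong by (metis cong_iff_lin cong_sym)
  obtain u v where "u * p + v * q = gcd p q"
    using bezout_int by blast
  then have "x = (y + (k * u) * p) + (k * v) * q"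
    using k by (simp add: algebra_simps flip: distrib_left)
  then show ?thesis
    using period_mult[of G, OF p] period_mult[of G, OF q] by metis
qed

section \<open>Orbits of a bijection of a finite set\<close>

text \<open>
  Library facts on orbits ask for a permutation of the whole type. Since \<open>T\<close> is arbitrary
  outside \<open>S\<close>, it is replaced there by the identity, which does not affect orbits of points
  of \<open>S\<close>.
\<close>

lemma self_in_orbit_bij_betw:
  assumes bij: "bij_betw T S S" and "finite S" and x: "x \<in> S"
  shows "x \<in> orbit T x"
proof -
  define P where "P = perm_restrict T S"
  have "bij_betw P S S"
    using bij by (subst bij_betw_cong[of S P T]) (auto simp: P_def perm_restrict_simps)
  then have "P permutes S"
    by (rule bij_imp_permutes) (simp add: P_def perm_restrict_simps)
  then have "x \<in> orbit P x"
    using \<open>finite S\<close> by (meson permutation_permutes permutation_self_in_orbit)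
  moreover have "orbit T x = orbit P x"
    using bij x by (intro orbit_cong0[of x S]) (auto simp: P_def perm_restrict_simps bij_betw_def)
  ultimately show ?thesis by simp
qed

section \<open>Maps induced by a rotation\<close>

text \<open>
  The rotation of \<open>{1..p + q}\<close> adds \<open>p\<close> to the points up to \<open>q\<close> and subtracts \<open>q\<close>
  from the others. The map \<open>T\<close> is its first return map to \<open>{1..m}\<close>: if \<open>x \<le> q\<close> and
  \<open>x + p\<close> lies beyond \<open>m\<close>, a second step leads to \<open>x + p - q\<close>, which is positive
  because \<open>q \<le> m\<close> and at most \<open>m\<close> because \<open>p \<le> m\<close>. For \<open>m = p + q\<close> the middle
  case is void.
\<close>

locale induced_rotation =
  fixes p q m :: nat and T :: "nat \<Rightarrow> nat"
  assumes m_pos: "0 < m" and p_le: "p \<le> m" and q_le: "q \<le> m" and m_le: "m \<le> p + q"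
    and step: "\<And>x. x \<in> {1..m} \<Longrightarrow>
      int (T x) = int x + (if x + p \<le> m then int p else if x \<le> q then int p - int q else - int q)"
begin

lemma left: "0 < x \<Longrightarrow> x + p \<le> m \<Longrightarrow> T x = x + p"
  using step[of x] by simp

lemma middle: "m < x + p \<Longrightarrow> x \<le> q \<Longrightarrow> T x = x + p - q"
  using step[of x] p_le q_le by simp

lemma right: "q < x \<Longrightarrow> x \<le> m \<Longrightarrow> T x = x - q"
  using step[of x] m_le by simp

text \<open>
  An invariant function on \<open>{1..m}\<close> extends to an invariant function \<open>F\<close> of the full rotation:
  each of the points beyond \<open>m\<close> takes the value of the point \<open>x - q\<close> that the rotation
  sends it to. Unrolling the cycle \<open>{1..p + q}\<close> turns \<open>F\<close> into a function \<open>G\<close> on the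
  integers with periods \<open>p + q\<close> and \<open>p\<close>, hence also \<open>q\<close>.
\<close>

lemma invariant_eq_if_cong:
  fixes f :: "nat \<Rightarrow> 'b"
  assumes inv: "\<And>x. x \<in> {1..m} \<Longrightarrow> f (T x) = f x"
    and x: "x \<in> {1..m}" and y: "y \<in> {1..m}" and cong: "[x = y] (mod gcd p q)"
  shows "f x = f y"
proof -
  define F where "F x = (if x \<le> m then f x else f (x - q))" for x
  \<comment> \<open>The shift by one makes \<open>{1..p + q}\<close>, not \<open>{0..<p + q}\<close>, the system of representatives.\<close>
  define G where "G z = F (nat ((z - 1) mod int (p + q)) + 1)" for z
  have n_pos: "0 < p + q" using m_pos m_le by linarith
  have F_left: "F (x + p) = F x" if "0 < x" "x \<le> q" for x
  proof (cases "x + p \<le> m")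
    case True
    then show ?thesis using that left[of x] inv[of x] by (simp add: F_def)
  next
    case False
    then show ?thesis using that middle[of x] inv[of x] q_le by (simp add: F_def)
  qed
  have F_right: "F (x - q) = F x" if "q < x" "x \<le> p + q" for x
  proof (cases "x \<le> m")
    case True
    then have "x - q \<le> m" by simp
    then show ?thesis using that True right[of x] inv[of x] by (simp add: F_def)
  next
    case False
    then show ?thesis using that p_le by (simp add: F_def)
  qed
  have G_eq: "G (int x) = F x" if "0 < x" "x \<le> p + q" for x
  proof -
    have "(int x - 1) mod int (p + q) = int x - 1"
      using that by (intro mod_pos_pos_trivial) auto
    then show ?thesis using that by (simp add: G_def nat_diff_distrib)
  qed
  have G_n: "G (z + int (p + q)) = G z" for z
    by (simp add: G_def diff_add_eq[symmetric] del: of_nat_add)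
  have G_p: "G (z + int p) = G z" for z
  proof -
    define x where "x = nat ((z - 1) mod int (p + q)) + 1"
    have "0 \<le> (z - 1) mod int (p + q)" "(z - 1) mod int (p + q) < int (p + q)"
      using n_pos by (simp_all del: of_nat_add)
    then have int_x: "int x = (z - 1) mod int (p + q) + 1" and x_bounds: "0 < x" "x \<le> p + q"
      by (simp_all add: x_def nat_less_iff Suc_le_eq del: of_nat_add)
    define k where "k = (z - 1) div int (p + q)"
    have z: "z = int x + k * int (p + q)"
      unfolding int_x k_def using div_mult_mod_eq[of "z - 1" "int (p + q)"] by linarith
    have "G (z + int p) = G (int x + int p)"
      using period_mult[of G "int (p + q)" "int x + int p" k, OF G_n] z by (simp add: algebra_simps)
    also have "\<dots> = F x"
    proof (cases "x \<le> q")
      case True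
      then show ?thesis using G_eq[of "x + p"] F_left x_bounds by simp
    next
      case False
      then have "int x + int p = int (x - q) + int (p + q)" by simp
      then have "G (int x + int p) = G (int (x - q))" using G_n by metis
      then show ?thesis using False G_eq[of "x - q"] F_right x_bounds by simp
    qed
    also have "\<dots> = G z" by (simp add: G_def x_def)
    finally show ?thesis .
  qed
  have G_q: "G (z + int q) = G z" for z
    using G_p[of "z + int q"] G_n[of z] by (simp add: algebra_simps)
  have "[int x = int y] (mod gcd (int p) (int q))"
    using cong by (simp add: cong_int_iff)
  then have "G (int x) = G (int y)" by (rule period_gcd[OF G_p G_q])
  then show ?thesis using x y m_le G_eq[of x] G_eq[of y] by (simp add: F_def)
qed

lemma step_cong:
  assumes "x \<in> {1..m}"
  shows "[T x = x] (mod gcd p q)"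
proof -
  let ?g = "int (gcd p q)"
  have "int (T x) - int x \<in> {int p, int p - int q, - int q}"
    using step[OF assms] by simp
  moreover have "?g dvd int p" "?g dvd int q" by auto
  ultimately have "?g dvd int (T x) - int x" by auto
  then show ?thesis by (metis cong_iff_dvd_diff cong_int_iff)
qed

text \<open>
  Orbits correspond to residue classes modulo \<open>gcd p q\<close>. As \<open>gcd p q \<le> m\<close>, every class meets
  \<open>{1..m}\<close>, and \<open>{1..gcd p q}\<close> is a system of representatives.
\<close>

lemma card_orbits:
  assumes bij: "bij_betw T {1..m} {1..m}"
  shows "card (orbit T ` {1..m}) = gcd p q"
proof -
  let ?S = "{1..m}" and ?g = "gcd p q"
  have g_pos: "0 < ?g"
    using m_pos m_le by (cases "p = 0") auto
  have g_le: "?g \<le> m"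
    using m_pos m_le p_le q_le by (cases "p = 0") (auto intro: le_trans[OF gcd_le1_nat])
  have orbit_cong: "orbit T x = orbit T y \<longleftrightarrow> [x = y] (mod ?g)" if "x \<in> ?S" "y \<in> ?S" for x y
  proof
    assume "orbit T x = orbit T y"
    then have "x \<in> orbit T y"
      using self_in_orbit_bij_betw[OF bij finite_atLeastAtMost] that by auto
    then have "x \<in> ?S \<and> [x = y] (mod ?g)"
    proof induction
      case base
      then show ?case using step_cong that bij by (auto simp: bij_betw_def)
    next
      case (step x)
      then show ?case using step_cong[of x] bij by (auto simp: bij_betw_def intro: cong_trans)
    qed
    then show "[x = y] (mod ?g)" ..
  next
    assume "[x = y] (mod ?g)"
    moreover have "orbit T (T z) = orbit T z" if "z \<in> ?S" for z
      using self_in_orbit_bij_betw[OF bij finite_atLeastAtMost that] by (rule self_in_orbit_step)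
    ultimately show "orbit T x = orbit T y"
      using invariant_eq_if_cong[of "orbit T"] that by blast
  qed
  define rep where "rep x = (x - 1) mod ?g + 1" for x
  have rep: "rep x \<in> {1..?g}" "[rep x = x] (mod ?g)" if "x \<in> ?S" for x
  proof -
    show "rep x \<in> {1..?g}"
      using g_pos by (auto simp: rep_def Suc_le_eq)
    have "[(x - 1) mod ?g + 1 = x - 1 + 1] (mod ?g)"
      by (intro cong_add) (auto simp: cong_def)
    then show "[rep x = x] (mod ?g)" using that by (simp add: rep_def)
  qed
  have "inj_on (orbit T) {1..?g}"
  proof (rule inj_onI)
    fix x y assume xy: "x \<in> {1..?g}" "y \<in> {1..?g}" "orbit T x = orbit T y"
    then have "[x - 1 + 1 = y - 1 + 1] (mod ?g)" using orbit_cong[of x y] g_le by auto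
    then have "[x - 1 = y - 1] (mod ?g)" by (simp only: cong_add_rcancel_nat)
    then have "x - 1 = y - 1"
      using xy g_pos by (intro cong_less_modulus_unique_nat[of "x - 1" "y - 1" ?g]) auto
    then show "x = y" using xy by auto
  qed
  moreover have "orbit T ` ?S = orbit T ` {1..?g}"
  proof
    show "orbit T ` ?S \<subseteq> orbit T ` {1..?g}"
    proof clarify
      fix x assume x: "x \<in> ?S"
      then have "orbit T x = orbit T (rep x)"
        using orbit_cong[of "rep x" x] rep[of x] g_le by auto
      then show "orbit T x \<in> orbit T ` {1..?g}" using rep[OF x] by auto
    qed
    show "orbit T ` {1..?g} \<subseteq> orbit T ` ?S" using g_le by (intro image_mono) auto
  qed
  ultimately show ?thesis by (simp add: card_image)
qed

end

section \<open>The translation vector of an interval exchange\<close>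

text \<open>
  The entries \<open>1\<close> in row \<open>a\<close> of \<open>\<Omega>\<close> mark the letters that precede \<open>a\<close> in the image only,
  the entries \<open>-1\<close> those that precede \<open>a\<close> in the domain only; letters preceding \<open>a\<close> in both
  orders contribute to both offsets and cancel.
\<close>

lemma Omega_vec_eq_offset_diff:
  fixes D A :: "'a::finite rel"
  assumes "strict_total_order D" and "strict_total_order A"
  shows "Omega_vec D A l $ a = int (offset A l a) - int (offset D l a)"
proof -
  have asym: "(x, y) \<in> r \<Longrightarrow> (y, x) \<notin> r" if "strict_total_order r" for r :: "'a rel" and x y
    using that unfolding strict_linear_order_on_def by (meson irrefl_def transD)
  have tot: "(x, y) \<in> r \<or> (y, x) \<in> r \<or> x = y" if "strict_total_order r" for r :: "'a rel" and x y
    using that unfolding strict_linear_order_on_def total_on_def by blast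
  have off: "int (offset r l a) = (\<Sum>j\<in>UNIV. (if (j, a) \<in> r then int (l $ j) else 0))" for r :: "'a rel"
    by (simp add: offset_def sum.If_cases)
  have "Omega D A $ a $ j * int (l $ j)
      = (if (j, a) \<in> A then int (l $ j) else 0) - (if (j, a) \<in> D then int (l $ j) else 0)" for j
    using asym[OF assms(1), of a j] asym[OF assms(2), of a j]
      asym[OF assms(1), of j a] asym[OF assms(2), of j a]
      tot[OF assms(1), of a j] tot[OF assms(2), of a j]
    by (auto simp: Omega_def)
  then show ?thesis
    by (simp add: Omega_vec_def matrix_vector_mult_def off sum_subtractf)
qed

lemma discrete_iet_translation:
  assumes "strict_total_order D" and "strict_total_order A"
    and iet: "discrete_iet D A l T" and x: "x \<in> block D l a"
  shows "int (T x) = int x + Omega_vec D A l $ a"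
proof -
  from iet obtain c where img: "T ` block D l a = block A l a"
    and c: "\<And>x. x \<in> block D l a \<Longrightarrow> int (T x) = int x + c"
    unfolding discrete_iet_def by metis
  let ?d = "int (offset D l a)" and ?e = "int (offset A l a)"
  \<comment> \<open>The images of the two end points of the domain block bound \<open>c\<close> from both sides.\<close>
  have pos: "0 < l $ a" using x by (auto simp: block_def)
  have "T (Suc (offset D l a)) \<in> block A l a" "T (offset D l a + l $ a) \<in> block A l a"
    using pos unfolding img[symmetric] by (auto simp: block_def)
  then have "?d + c \<ge> ?e" "?d + c \<le> ?e"
    using c[of "Suc (offset D l a)"] c[of "offset D l a + l $ a"] pos by (auto simp: block_def)
  then show ?thesis
    using c[OF x] by (simp add: Omega_vec_eq_offset_diff assms(1,2))
qed

section \<open>Three letters\<close>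

lemma strict_total_order_three:
  fixes r :: "'a::finite rel"
  assumes "CARD('a) = 3" and "strict_total_order r"
  obtains a b c where "distinct [a, b, c]" and "(UNIV :: 'a set) = {a, b, c}"
    and "r = {(a, b), (a, c), (b, c)}"
proof -
  obtain x y z :: 'a where xyz: "(UNIV :: 'a set) = {x, y, z}" "x \<noteq> y" "x \<noteq> z" "y \<noteq> z"
    using assms(1) by (auto simp: card_3_iff)
  have tr: "trans r" and irr: "\<And>u. (u, u) \<notin> r"
    and tot: "\<And>u v. u \<noteq> v \<Longrightarrow> (u, v) \<in> r \<or> (v, u) \<in> r"
    using assms(2) by (auto simp: strict_linear_order_on_def irrefl_def total_on_def)
  have "\<exists>a b c. distinct [a, b, c] \<and> {x, y, z} = {a, b, c} \<and> (a, b) \<in> r \<and> (b, c) \<in> r"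
    using tot[of x y] tot[of x z] tot[of y z] xyz tr
    by (smt (verit) distinct_length_2_or_more distinct_singleton insert_commute)
  then obtain a b c where abc: "distinct [a, b, c]" "(UNIV :: 'a set) = {a, b, c}"
    "(a, b) \<in> r" "(b, c) \<in> r"
    using xyz by metis
  have "(u, v) \<in> r \<longleftrightarrow> (u, v) \<in> {(a, b), (a, c), (b, c)}" for u v
  proof -
    have "u \<in> {a, b, c}" "v \<in> {a, b, c}" using abc(2) by blast+
    moreover have "(a, c) \<in> r" "(b, a) \<notin> r" "(c, b) \<notin> r" "(c, a) \<notin> r"
      using abc tr irr by (meson transD)+
    ultimately show ?thesis using abc(1,3,4) irr[of a] irr[of b] irr[of c]
      by (elim insertE emptyE) auto
  qed
  then have "r = {(a, b), (a, c), (b, c)}" by (intro set_eqI) (metis surj_pair)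
  then show ?thesis by (rule that[OF abc(1,2)])
qed

lemma offset_three:
  assumes "distinct [a, b, c]"
  shows "offset {(a, b), (a, c), (b, c)} l a = 0"
    and "offset {(a, b), (a, c), (b, c)} l b = l $ a"
    and "offset {(a, b), (a, c), (b, c)} l c = l $ a + l $ b"
proof -
  let ?r = "{(a, b), (a, c), (b, c)}"
  have "{x. (x, a) \<in> ?r} = {}" "{x. (x, b) \<in> ?r} = {a}" "{x. (x, c) \<in> ?r} = {a, b}"
    using assms by auto
  then show "offset ?r l a = 0" "offset ?r l b = l $ a" "offset ?r l c = l $ a + l $ b"
    using assms by (simp_all add: offset_def)
qed

text \<open>
  With the letters named \<open>a, b, c\<close> in domain order, each of the five image orders other than
  \<open>a, b, c\<close> gives a translation vector from which \<open>p\<close> and \<open>q\<close> can be read off as the largest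
  entry and minus the smallest one. The third entry is \<open>p - q\<close> for the reversal and otherwise
  \<open>p\<close>, \<open>- q\<close> or \<open>0\<close>, so it does not change the gcd.
\<close>

lemma discrete_iet_induced_rotation:
  fixes D A :: "'a::finite rel" and l :: "nat ^ 'a" and T :: "nat \<Rightarrow> nat"
  assumes card: "CARD('a) = 3"
    and D: "strict_total_order D" and A: "strict_total_order A" and neq: "D \<noteq> A"
    and pos: "total_length l \<ge> 1"
    and iet: "discrete_iet D A l T"
    and no_fixed: "no_fixed_letter D A l"
  obtains p q where "induced_rotation p q (total_length l) T"
    and "gcd_entries (Omega_vec D A l) = int (gcd p q)"
proof -
  let ?m = "total_length l" and ?v = "Omega_vec D A l"
  obtain a b c where abc: "distinct [a, b, c]" and UN: "(UNIV :: 'a set) = {a, b, c}"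
    and D_eq: "D = {(a, b), (a, c), (b, c)}"
    using strict_total_order_three[OF card D] .
  obtain a' b' c' where abc': "distinct [a', b', c']"
    and A_eq: "A = {(a', b'), (a', c'), (b', c')}"
    using strict_total_order_three[OF card A] .
  have m: "?m = l $ a + l $ b + l $ c"
    using abc by (simp add: total_length_def UN)
  note oD = offset_three[OF abc, of l, folded D_eq]
  note oA = offset_three[OF abc', of l, folded A_eq]
  have v: "?v $ x = int (offset A l x) - int (offset D l x)" for x
    by (rule Omega_vec_eq_offset_diff[OF D A])
  note trans = discrete_iet_translation[OF D A iet, unfolded block_def]
  have T: "int (T x) = int x +
      (if x \<le> l $ a then ?v $ a else if x \<le> l $ a + l $ b then ?v $ b else ?v $ c)"
    if "x \<in> {1..?m}" for x
    using that trans[of x a] trans[of x b] trans[of x c] by (simp add: oD m)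
  have g: "gcd_entries ?v = gcd (?v $ a) (gcd (?v $ b) (?v $ c))"
    by (simp add: gcd_entries_def UN)
  have fixed: "l $ x = 0" if "\<And>y. Omega D A $ x $ y = 0" for x
    using no_fixed that by (simp add: no_fixed_letter_def vec_eq_iff)
  have "a' \<in> {a, b, c}" "b' \<in> {a, b, c}" "c' \<in> {a, b, c}" using UN by blast+
  then consider "a' = a" "b' = b" "c' = c" | "a' = c" "b' = b" "c' = a"
    | "a' = b" "b' = c" "c' = a" | "a' = c" "b' = a" "c' = b"
    | "a' = b" "b' = a" "c' = c" | "a' = a" "b' = c" "c' = b"
    using abc' by auto
  then show ?thesis
  proof cases
    case 1
    then show ?thesis using neq A_eq D_eq by simp
  next
    case 2
    \<comment> \<open>The image order is the reversal; the entry at \<open>b\<close> is written as \<open>p - q\<close> with \<open>l $ b\<close> uncancelled.\<close>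
    have vv: "?v $ a = int (l $ b + l $ c)"
      "?v $ b = int (l $ b + l $ c) - int (l $ a + l $ b)" "?v $ c = - int (l $ a + l $ b)"
      using oA unfolding 2 by (simp_all add: v oD)
    show ?thesis
    proof (rule that[of "l $ b + l $ c" "l $ a + l $ b"])
      show "induced_rotation (l $ b + l $ c) (l $ a + l $ b) ?m T"
        using pos by unfold_locales (auto simp: T vv m)
      show "gcd_entries ?v = int (gcd (l $ b + l $ c) (l $ a + l $ b))"
        unfolding g vv by (simp only: gcd_neg2 gcd_diff1 gcd_left_idem gcd_int_int_eq)
    qed
  next
    case 3
    \<comment> \<open>The letters \<open>b\<close> and \<open>c\<close> move as one interval.\<close>
    have vv: "?v $ a = int (l $ b + l $ c)" "?v $ b = - int (l $ a)" "?v $ c = - int (l $ a)"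
      using oA unfolding 3 by (simp_all add: v oD)
    show ?thesis
    proof (rule that[of "l $ b + l $ c" "l $ a"])
      show "induced_rotation (l $ b + l $ c) (l $ a) ?m T"
        using pos by unfold_locales (auto simp: T vv m)
      show "gcd_entries ?v = int (gcd (l $ b + l $ c) (l $ a))"
        by (simp add: g vv del: of_nat_add)
    qed
  next
    case 4
    \<comment> \<open>The letters \<open>a\<close> and \<open>b\<close> move as one interval.\<close>
    have vv: "?v $ a = int (l $ c)" "?v $ b = int (l $ c)" "?v $ c = - int (l $ a + l $ b)"
      using oA unfolding 4 by (simp_all add: v oD)
    show ?thesis
    proof (rule that[of "l $ c" "l $ a + l $ b"])
      show "induced_rotation (l $ c) (l $ a + l $ b) ?m T"
        using pos by unfold_locales (auto simp: T vv m)
      show "gcd_entries ?v = int (gcd (l $ c) (l $ a + l $ b))"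
        by (simp add: g vv del: of_nat_add)
    qed
  next
    case 5
    \<comment> \<open>The letter \<open>c\<close> is last in both orders, so its row of \<open>Omega D A\<close> vanishes.\<close>
    have len_0: "l $ c = 0"
    proof (rule fixed)
      fix y
      have "y \<in> {a, b, c}" using UN by blast
      then show "Omega D A $ c $ y = 0"
        using abc abc' unfolding Omega_def D_eq A_eq 5 by auto
    qed
    have vv: "?v $ a = int (l $ b)" "?v $ b = - int (l $ a)" "?v $ c = 0"
      using oA unfolding 5 by (simp_all add: v oD len_0)
    show ?thesis
    proof (rule that[of "l $ b" "l $ a"])
      show "induced_rotation (l $ b) (l $ a) ?m T"
        using pos by unfold_locales (auto simp: T vv m len_0)
      show "gcd_entries ?v = int (gcd (l $ b) (l $ a))"
        by (simp add: g vv del: of_nat_add)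
    qed
  next
    case 6
    \<comment> \<open>The letter \<open>a\<close> is first in both orders, so its row of \<open>Omega D A\<close> vanishes.\<close>
    have len_0: "l $ a = 0"
    proof (rule fixed)
      fix y
      have "y \<in> {a, b, c}" using UN by blast
      then show "Omega D A $ a $ y = 0"
        using abc abc' unfolding Omega_def D_eq A_eq 6 by auto
    qed
    have vv: "?v $ a = 0" "?v $ b = int (l $ c)" "?v $ c = - int (l $ b)"
      using oA unfolding 6 by (simp_all add: v oD len_0)
    show ?thesis
    proof (rule that[of "l $ c" "l $ b"])
      show "induced_rotation (l $ c) (l $ b) ?m T"
        using pos by unfold_locales (auto simp: T vv m len_0)
      show "gcd_entries ?v = int (gcd (l $ c) (l $ b))"
        by (simp add: g vv del: of_nat_add)
    qed
  qed
qed

theorem corollary2: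
  fixes D A :: "'a::finite rel" and l :: "nat ^ 'a" and T :: "nat \<Rightarrow> nat"
  assumes "CARD('a) = 3"
    and "strict_total_order D" and "strict_total_order A" and "D \<noteq> A"
    and "total_length l \<ge> 1"
    and "discrete_iet D A l T"
    and "no_fixed_letter D A l"
  shows "int (card (iet_orbits l T)) = gcd_entries (Omega_vec D A l) \<and>
         (minimal_iet l T \<longleftrightarrow> gcd_entries (Omega_vec D A l) = 1)"
proof -
  obtain p q where rot: "induced_rotation p q (total_length l) T"
    and g: "gcd_entries (Omega_vec D A l) = int (gcd p q)"
    using discrete_iet_induced_rotation[OF assms] .
  have "bij_betw T {1..total_length l} {1..total_length l}"
    using assms(6) by (simp add: discrete_iet_def)
  then have "card (iet_orbits l T) = gcd p q"
    unfolding iet_orbits_def by (rule induced_rotation.card_orbits[OF rot])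
  then show ?thesis
    by (simp add: g minimal_iet_def is_singleton_altdef)
qed

end
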